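(* Let $n>1$ be an integer, let $p_n(z)=z(z^n-1)$, let $C_n$ be Chebyshev's method applied to $p_n$, and let $\mathcal A_0$ be the immediate basin of $C_n$ corresponding to the root $0$ of $p_n$. Then: (1) $\mathcal A_0$ is unbounded whenever $n\le 16$; (2) $\mathcal A_0$ is bounded whenever $n\ge 17$.
   Context: Chebyshev's method applied to a polynomial $p$ is the rational map $C_p(z)=z-\left(1+\frac12 L_p(z)\right)\frac{p(z)}{p'(z)}$, where $L_p(z)=\frac{p(z)p''(z)}{(p'(z))^2}$, viewed as a self-map of the Riemann sphere $\widehat{\mathbb C}$. For $p_n(z)=z(z^n-1)$ one has $C_n(z)=\frac{z^{n+1}\left(n(n+1)(2n+1)z^{2n}-2n(n+1)z^n-n(n-1)\right)}{2\left((n+1)z^n-1\right)^3}$. The origin is a superattracting fixed point of $C_n$. The basin of attraction of an attracting fixed point $z_0$ of $C_n$ is $\{z\in\widehat{\mathbb C}:\lim_{m\to\infty}C_n^m(z)=z_0\}$, where $C_n^m$ is the $m$-fold iterate; the immediate basin of $z_0$ is the connected component of the basin containing $z_0$. Bounded and unbounded refer to subsets of the plane. *)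

theory Defs
  imports "HOL-Analysis.Analysis" "HOL-Computational_Algebra.Computational_Algebra"
    "HOL-Computational_Algebra.Field_as_Ring"
begin

text \<open>The Riemann sphere is the one-point compactification of the plane; \<open>None\<close> is the point at
  infinity.\<close>

definition riemann_sphere :: "complex option topology" where
  "riemann_sphere = Alexandroff_compactification euclidean"

text \<open>A rational function over the complex numbers acts on the sphere via its reduced fraction
  \<open>a / b\<close>. The value at infinity is the limit of \<open>a z / b z\<close> as \<open>z\<close> tends to infinity, which is
  read off from the degrees and the coefficients of \<open>z ^ degree b\<close>.\<close>

definition rational_map :: "complex poly fract \<Rightarrow> complex option \<Rightarrow> complex option" where
  "rational_map R w = (let (a, b) = quot_of_fract R in
     case w of
       Some z \<Rightarrow> if poly b z = 0 then None else Some (poly a z / poly b z)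
     | None \<Rightarrow> if degree a > degree b then None
               else Some (coeff a (degree b) / lead_coeff b))"

definition chebyshev_L :: "complex poly \<Rightarrow> complex poly fract" where
  "chebyshev_L p = to_fract p * to_fract (pderiv (pderiv p)) / (to_fract (pderiv p))\<^sup>2"

definition chebyshev_fract :: "complex poly \<Rightarrow> complex poly fract" where
  "chebyshev_fract p =
     to_fract [:0, 1:] - (1 + 1 / 2 * chebyshev_L p) * (to_fract p / to_fract (pderiv p))"

definition chebyshev :: "complex poly \<Rightarrow> complex option \<Rightarrow> complex option" where
  "chebyshev p = rational_map (chebyshev_fract p)"

definition basin :: "(complex option \<Rightarrow> complex option) \<Rightarrow> complex option \<Rightarrow> complex option set" where
  "basin f w = {z. limitin riemann_sphere (\<lambda>m. (f ^^ m) z) w sequentially}"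

definition immediate_basin ::
    "(complex option \<Rightarrow> complex option) \<Rightarrow> complex option \<Rightarrow> complex option set" where
  "immediate_basin f w = connected_component_of_set (subtopology riemann_sphere (basin f w)) w"

definition p_poly :: "nat \<Rightarrow> complex poly" where
  "p_poly n = [:0, 1:] * (monom 1 n - 1)"

text \<open>This is a subset of the sphere. Its boundedness is that of its part in the plane,
  \<open>Some -` A0 n\<close>. Nothing is lost: infinity is a fixed point of the Chebyshev map of \<open>p_poly n\<close>,
  so it does not belong to \<open>A0 n\<close>.\<close>

definition A0 :: "nat \<Rightarrow> complex option set" where
  "A0 n = immediate_basin (chebyshev (p_poly n)) (Some 0)"

end

theory Submission
  imports Defs
begin

text \<open>The map commutes with rotation by \<open>n\<close>-th roots of unity, so it has the
  form \<open>z \<mapsto> z * growth n u\<close>, where \<open>u = (n + 1) * z ^ n\<close> and the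
  modulus of the rational function \<open>growth n\<close> says whether a point moves away from
  the origin or towards it. Normalised in this way, all poles lie over \<open>u = 1\<close>, and
  the free critical points over \<open>u = - (n - 1) / (2 * n + 1)\<close>, close to
  \<open>-1/2\<close>. The threshold comes from the number \<open>- growth n (-1/2) = 2 * n / (27
  * (n + 1)) * (n - 2 - (2 * n + 1) / (4 * (n + 1)))\<close>, which is below 1 for \<open>n =
  16\<close> and above 1 for \<open>n = 17\<close>.

  For \<open>n \<ge> 17\<close> the circle \<open>\<bar>u\<bar> = 1/2\<close> is a barrier. By the
  triangle inequality \<open>\<bar>growth n u\<bar>\<close> is smallest on it at \<open>u =
  -1/2\<close> (\<open>growth_ge_1_on_circle\<close>), so no point of the circle is mapped inside
  it. Consider the points of the basin whose whole orbit stays in the closed disc. They form a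
  closed subset of the basin. An orbit among them never meets the circle, since it could not get
  back inside and converge to 0; hence the condition is really about the open disc, and as all but
  finitely many points of an orbit lie near 0, it is also an open condition. So a connected set in
  the basin that contains 0 cannot leave the disc (\<open>connected_basin_trapped\<close>).

  For \<open>n \<le> 16\<close> the rays on which \<open>u \<le> 0\<close> lie in the basin. On
  them \<open>\<bar>growth n u\<bar> \<le> 99/100\<close> (\<open>abs_overshoot_le\<close>). If
  \<open>n\<close> is even, the map sends them into one another. If \<open>n\<close> is odd, a
  point where \<open>growth n u\<close> is negative is sent to a ray with \<open>u > 0\<close>,
  but then it lands in the disc \<open>\<bar>u\<bar> \<le> 1/10\<close>
  (\<open>odd_landing\<close>), which is contracted too. So the rays together with the disc form
  an invariant set on which the map is a contraction towards 0
  (\<open>cheb_step_contracted\<close>). A single ray is connected, unbounded and contains 0.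
  Parity matters for \<open>n = 16\<close>: there some points of a ray cross the origin and land
  outside the disc.\<close>

section \<open>Evaluating a rational map from an unreduced fraction\<close>

lemma coprime_polys_no_common_root:
  fixes a b :: "complex poly"
  assumes "coprime a b" "poly a z = 0"
  shows "poly b z \<noteq> 0"
proof
  assume "poly b z = 0"
  with assms(2) have "[:- z, 1:] dvd a" "[:- z, 1:] dvd b"
    by (simp_all add: poly_eq_0_iff_dvd)
  with assms(1) have "is_unit [:- z, 1:]"
    by (rule coprime_common_divisor)
  then show False
    by (simp add: is_unit_iff_degree)
qed

text \<open>The values of \<open>rational_map\<close> refer to the reduced fraction, which is not
  known explicitly. Cross multiplication with a given, possibly unreduced, fraction is all that is
  needed to compute with it.\<close>
lemma quot_of_fract_cross:
  fixes c d :: "complex poly"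
  assumes "d \<noteq> 0" and "R = to_fract c / to_fract d"
  obtains a b where "quot_of_fract R = (a, b)" "coprime a b" "b \<noteq> 0" "a * d = c * b"
proof -
  obtain a b where ab: "quot_of_fract R = (a, b)"
    by fastforce
  then have "b \<noteq> 0" "coprime a b"
    using snd_quot_of_fract_nonzero[of R] coprime_quot_of_fract[of R] by auto
  moreover have "R = to_fract a / to_fract b"
    using to_fract_quot_of_fract[of R] Fract_quot_of_fract[of R] ab
    by (simp add: Fract_conv_to_fract)
  then have "to_fract (a * d) = to_fract (c * b)"
    using assms \<open>b \<noteq> 0\<close> by (simp add: frac_eq_eq)
  then have "a * d = c * b"
    by (simp only: to_fract_eq_iff)
  ultimately show thesis
    using that ab by blast
qed

lemma rational_map_Some:
  assumes "poly d z \<noteq> 0" and R: "R = to_fract c / to_fract d"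
  shows "rational_map R (Some z) = Some (poly c z / poly d z)"
proof -
  have "d \<noteq> 0"
    using assms(1) by auto
  then obtain a b where ab: "quot_of_fract R = (a, b)" "coprime a b" "a * d = c * b"
    using quot_of_fract_cross[OF _ R] by metis
  have eq: "poly a z * poly d z = poly c z * poly b z"
    using arg_cong[OF ab(3), of "\<lambda>q. poly q z"] by simp
  have "poly b z \<noteq> 0"
  proof
    assume "poly b z = 0"
    with eq assms(1) have "poly a z = 0"
      by simp
    with ab(2) \<open>poly b z = 0\<close> show False
      using coprime_polys_no_common_root by blast
  qed
  with eq assms(1) show ?thesis
    by (simp add: rational_map_def ab(1) field_simps)
qed

lemma rational_map_pole:
  assumes "d \<noteq> 0" "poly d z = 0" "poly c z \<noteq> 0" and R: "R = to_fract c / to_fract d"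
  shows "rational_map R (Some z) = None"
proof -
  obtain a b where ab: "quot_of_fract R = (a, b)" "a * d = c * b"
    using quot_of_fract_cross[OF assms(1) R] by metis
  have "poly a z * poly d z = poly c z * poly b z"
    using arg_cong[OF ab(2), of "\<lambda>q. poly q z"] by simp
  with assms(2,3) show ?thesis
    by (simp add: rational_map_def ab(1))
qed

lemma rational_map_None:
  assumes "d \<noteq> 0" "degree c > degree d" and R: "R = to_fract c / to_fract d"
  shows "rational_map R None = None"
proof -
  obtain a b where ab: "quot_of_fract R = (a, b)" "b \<noteq> 0" "a * d = c * b"
    using quot_of_fract_cross[OF assms(1) R] by metis
  have "c \<noteq> 0"
    using assms(2) by auto
  then have "a \<noteq> 0"
    using ab by auto
  have "degree a + degree d = degree c + degree b"
    using arg_cong[OF ab(3), of degree] \<open>a \<noteq> 0\<close> \<open>b \<noteq> 0\<close> \<open>c \<noteq> 0\<close> \<open>d \<noteq> 0\<close>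
    by (simp add: degree_mult_eq)
  with assms(2) show ?thesis
    by (simp add: rational_map_def ab(1))
qed

section \<open>The Chebyshev map in closed form\<close>

lemma chebyshev_fract_eq:
  assumes "pderiv p \<noteq> 0"
  shows "chebyshev_fract p =
    to_fract (2 * [:0, 1:] * pderiv p ^ 3 - 2 * p * pderiv p ^ 2 - p ^ 2 * pderiv (pderiv p)) /
    to_fract (2 * pderiv p ^ 3)"
proof -
  define x where "x = to_fract ([:0, 1:] :: complex poly)"
  define P where "P = to_fract p"
  define Q where "Q = to_fract (pderiv p)"
  define T where "T = to_fract (pderiv (pderiv p))"
  have two: "to_fract (2 :: complex poly) = 2"
    using to_fract_add[of "1 :: complex poly" 1] by simp
  have "Q \<noteq> 0"
    using assms by (simp add: Q_def)
  have "(2 :: complex poly fract) \<noteq> 0"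
    unfolding two[symmetric] to_fract_eq_0_iff by simp
  have "chebyshev_fract p = x - (1 + 1 / 2 * (P * T / Q\<^sup>2)) * (P / Q)"
    by (simp only: chebyshev_fract_def chebyshev_L_def x_def P_def Q_def T_def)
  also have "\<dots> = (2 * x * Q ^ 3 - 2 * P * Q ^ 2 - P ^ 2 * T) / (2 * Q ^ 3)"
    using \<open>Q \<noteq> 0\<close> \<open>(2 :: complex poly fract) \<noteq> 0\<close>
    by (simp add: divide_simps) (simp add: algebra_simps power2_eq_square power3_eq_cube)
  finally show ?thesis
    by (simp only: two x_def P_def Q_def T_def power2_eq_square power3_eq_cube
        to_fract_diff to_fract_mult)
qed

lemma p_poly_eq: "p_poly n = monom 1 (n + 1) - monom 1 1"
  by (rule poly_eqI) (simp add: p_poly_def coeff_pCons algebra_simps split: nat.split)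

lemma pderiv_p_poly: "pderiv (p_poly n) = monom (of_nat (n + 1)) n - 1"
  by (simp add: p_poly_eq pderiv_diff pderiv_monom monom_0 one_pCons)

lemma pderiv2_p_poly: "pderiv (pderiv (p_poly n)) = monom (of_nat n * of_nat (n + 1)) (n - 1)"
  by (simp add: pderiv_p_poly pderiv_diff pderiv_monom)

definition cheb_num :: "nat \<Rightarrow> complex poly" where
  "cheb_num n = monom (of_nat (n * (n + 1) * (2 * n + 1))) (3 * n + 1)
     - monom (of_nat (2 * n * (n + 1))) (2 * n + 1) - monom (of_nat n * (of_nat n - 1)) (n + 1)"

definition cheb_den :: "nat \<Rightarrow> complex poly" where
  "cheb_den n = 2 * (monom (of_nat (n + 1)) n - 1) ^ 3"

lemma cheb_den_nonzero: "n > 0 \<Longrightarrow> cheb_den n \<noteq> 0"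
proof -
  assume "n > 0"
  then have "poly (cheb_den n) 0 \<noteq> 0"
    by (simp add: cheb_den_def poly_monom zero_power)
  then show ?thesis
    by auto
qed

lemma chebyshev_fract_p_poly:
  assumes "n > 0"
  shows "chebyshev_fract (p_poly n) = to_fract (cheb_num n) / to_fract (cheb_den n)"
proof -
  have nz: "pderiv (p_poly n) \<noteq> 0"
    using cheb_den_nonzero[OF assms] by (auto simp: cheb_den_def pderiv_p_poly)
  have den: "cheb_den n = 2 * pderiv (p_poly n) ^ 3"
    by (simp add: cheb_den_def pderiv_p_poly)
  have "cheb_num n = 2 * [:0, 1:] * pderiv (p_poly n) ^ 3 - 2 * p_poly n * pderiv (p_poly n) ^ 2
      - p_poly n ^ 2 * pderiv (pderiv (p_poly n))"
  proof (rule poly_ext)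
    fix z :: complex
    have poly_X: "poly [:0, 1:] z = z"
      by simp
    define w where "w = z ^ n"
    obtain m where m: "n = Suc m"
      using assms gr0_implies_Suc by blast
    have pw: "z ^ (3 * n + 1) = z * w ^ 3" "z ^ (2 * n + 1) = z * w ^ 2" "z ^ (n + 1) = z * w"
      by (simp_all add: w_def flip: power_mult, simp_all add: mult.commute)
    have low: "z\<^sup>2 * z ^ (n - 1) = z * w"
      by (simp add: w_def m power2_eq_square)
    define k :: complex where "k = of_nat n"
    have p: "poly (p_poly n) z = z * (w - 1)"
      by (simp add: p_poly_def poly_monom w_def)
    have p2: "poly (p_poly n ^ 2 * pderiv (pderiv (p_poly n))) z = z * w * (w - 1)\<^sup>2 * (k * (k + 1))"
    proof -
      have "poly (p_poly n ^ 2 * pderiv (pderiv (p_poly n))) z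
          = (z\<^sup>2 * z ^ (n - 1)) * (w - 1)\<^sup>2 * (k * (k + 1))"
        unfolding poly_mult poly_power p pderiv2_p_poly poly_monom
        unfolding power_mult_distrib
        by (simp add: k_def)
      then show ?thesis
        by (simp only: low)
    qed
    have q: "poly (pderiv (p_poly n)) z = (k + 1) * w - 1"
      by (simp add: pderiv_p_poly poly_monom w_def k_def algebra_simps)
    have c: "poly (cheb_num n) z = k * (k + 1) * (2 * k + 1) * (z * w ^ 3)
        - 2 * k * (k + 1) * (z * w ^ 2) - k * (k - 1) * (z * w)"
      unfolding cheb_num_def poly_diff poly_monom pw
      by (simp add: k_def algebra_simps)
    show "poly (cheb_num n) z = poly (2 * [:0, 1:] * pderiv (p_poly n) ^ 3
        - 2 * p_poly n * pderiv (p_poly n) ^ 2 - p_poly n ^ 2 * pderiv (pderiv (p_poly n))) z"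
      unfolding poly_diff p2
      unfolding c poly_mult poly_power p q poly_numeral poly_X
      by algebra
  qed
  then show ?thesis
    by (simp only: den chebyshev_fract_eq[OF nz])
qed

lemma degree_cheb_num:
  assumes "n > 0"
  shows "degree (cheb_num n) > degree (cheb_den n)"
proof -
  have "coeff (cheb_num n) (3 * n + 1) = of_nat (n * (n + 1) * (2 * n + 1))"
    using assms by (simp add: cheb_num_def)
  also have "\<dots> \<noteq> 0"
    using assms by (subst of_nat_eq_0_iff) simp
  finally have "3 * n + 1 \<le> degree (cheb_num n)"
    by (rule le_degree)
  moreover have "degree (monom (of_nat (n + 1)) n - 1 :: complex poly) \<le> n"
    by (intro degree_diff_le degree_monom_le) simp
  then have "degree (cheb_den n) \<le> 3 * n"
    unfolding cheb_den_def
    using degree_mult_le[of "2 :: complex poly" "(monom (of_nat (n + 1)) n - 1) ^ 3"]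
      degree_power_le[of "monom (of_nat (n + 1)) n - 1 :: complex poly" 3]
    by (simp add: degree_numeral) 
  ultimately show ?thesis
    by simp
qed

text \<open>The coordinate \<open>u\<close> in which the argument is carried out is
  \<open>scaled_power n z\<close>; the factor \<open>n + 1\<close> moves the poles to \<open>u =
  1\<close>, independently of \<open>n\<close>.\<close>
definition growth :: "nat \<Rightarrow> complex \<Rightarrow> complex" where
  "growth n u = of_nat n * u * ((2 * of_nat n + 1) / (of_nat n + 1) * u\<^sup>2 - 2 * u - (of_nat n - 1)) /
     (2 * (of_nat n + 1) * (u - 1) ^ 3)"

definition scaled_power :: "nat \<Rightarrow> complex \<Rightarrow> complex" where
  "scaled_power n z = (of_nat n + 1) * z ^ n"

definition cheb_step :: "nat \<Rightarrow> complex \<Rightarrow> complex" where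
  "cheb_step n z = z * growth n (scaled_power n z)"

lemma poly_cheb_den: "poly (cheb_den n) z = 2 * (scaled_power n z - 1) ^ 3"
  by (simp add: cheb_den_def scaled_power_def poly_monom algebra_simps)

lemma of_nat_plus_1_nonzero: "(of_nat n + 1 :: complex) \<noteq> 0"
  using of_nat_neq_0[of n, where 'a = complex] by (simp add: add.commute)

lemma poly_cheb_num:
  "poly (cheb_num n) z = z * (of_nat n * scaled_power n z *
    ((2 * of_nat n + 1) / (of_nat n + 1) * (scaled_power n z)\<^sup>2 - 2 * scaled_power n z - (of_nat n - 1)) /
    (of_nat n + 1))"
proof -
  define w where "w = z ^ n"
  define k :: complex where "k = of_nat n"
  have "k + 1 \<noteq> 0"
    using of_nat_plus_1_nonzero by (simp add: k_def)
  have pw: "z ^ (3 * n + 1) = z * w ^ 3" "z ^ (2 * n + 1) = z * w ^ 2" "z ^ (n + 1) = z * w"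
    by (simp_all add: w_def flip: power_mult, simp_all add: mult.commute)
  have "poly (cheb_num n) z = k * (k + 1) * (2 * k + 1) * (z * w ^ 3)
      - 2 * k * (k + 1) * (z * w ^ 2) - k * (k - 1) * (z * w)"
    unfolding cheb_num_def poly_diff poly_monom pw
    by (simp add: k_def algebra_simps)
  also have "\<dots> = z * (k * w * ((2 * k + 1) * (k + 1) * w\<^sup>2 - 2 * ((k + 1) * w) - (k - 1)))"
    by algebra
  also have "(2 * k + 1) * (k + 1) * w\<^sup>2 = (2 * k + 1) / (k + 1) * ((k + 1) * w)\<^sup>2"
    using \<open>k + 1 \<noteq> 0\<close> by (simp add: power2_eq_square)
  finally show ?thesis
    using \<open>k + 1 \<noteq> 0\<close> by (simp add: scaled_power_def flip: w_def k_def)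
qed

lemma chebyshev_Some:
  assumes "n > 0" "scaled_power n z \<noteq> 1"
  shows "chebyshev (p_poly n) (Some z) = Some (cheb_step n z)"
proof -
  have "poly (cheb_den n) z \<noteq> 0"
    using assms by (simp add: poly_cheb_den)
  from rational_map_Some[OF this chebyshev_fract_p_poly[OF assms(1)]] show ?thesis
    unfolding chebyshev_def poly_cheb_num poly_cheb_den cheb_step_def growth_def
    by (simp add: mult_ac)
qed

text \<open>The numerator does not vanish over \<open>u = 1\<close>, so the zeros of the
  denominator are genuine poles.\<close>
lemma chebyshev_pole:
  assumes "n > 0" "scaled_power n z = 1"
  shows "chebyshev (p_poly n) (Some z) = None"
  unfolding chebyshev_def
proof (rule rational_map_pole[OF _ _ _ chebyshev_fract_p_poly])
  show "poly (cheb_den n) z = 0"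
    using assms by (simp add: poly_cheb_den)
  have "z \<noteq> 0"
    using assms by (auto simp: scaled_power_def zero_power)
  define k :: complex where "k = of_nat n"
  have k: "k + 1 \<noteq> 0" "k \<noteq> 0"
    using of_nat_plus_1_nonzero assms by (simp_all add: k_def)
  have "(2 * k + 1) / (k + 1) - 2 - (k - 1) = - (k\<^sup>2 / (k + 1))"
    using k by (simp add: divide_simps) (simp add: algebra_simps power2_eq_square)
  then show "poly (cheb_num n) z \<noteq> 0"
    using k \<open>z \<noteq> 0\<close> by (simp add: poly_cheb_num assms(2) flip: k_def)
qed (use assms cheb_den_nonzero in auto)

lemma chebyshev_None:
  assumes "n > 0"
  shows "chebyshev (p_poly n) None = None"
  unfolding chebyshev_def
  by (rule rational_map_None[OF cheb_den_nonzero degree_cheb_num chebyshev_fract_p_poly])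
     (use assms in auto)

section \<open>Size of the growth factor on circles and discs\<close>

text \<open>Keeping this slowly varying coefficient abstract, with only the bounds
  \<open>5/3\<close> and \<open>2\<close>, makes the estimates below nearly uniform in
  \<open>n\<close>.\<close>
definition quad_coeff :: "nat \<Rightarrow> real" where
  "quad_coeff n = (2 * real n + 1) / (real n + 1)"

lemma quad_coeff_le: "quad_coeff n \<le> 2"
  by (simp add: quad_coeff_def divide_simps)

lemma quad_coeff_ge: "n \<ge> 2 \<Longrightarrow> 5 / 3 \<le> quad_coeff n"
  by (simp add: quad_coeff_def divide_simps)

lemma growth_eq:
  "growth n u = of_nat n * u * (of_real (quad_coeff n) * u\<^sup>2 - 2 * u - (of_nat n - 1)) /
     (2 * (of_nat n + 1) * (u - 1) ^ 3)"
  by (simp add: growth_def quad_coeff_def)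

lemma norm_growth:
  "norm (growth n u) = real n / (2 * (real n + 1)) *
     (norm u * norm (of_real (quad_coeff n) * u\<^sup>2 - 2 * u - (of_nat n - 1)) / norm (u - 1) ^ 3)"
proof -
  have "norm (of_nat n + 1 :: complex) = real n + 1"
    using norm_of_nat[of "n + 1", where 'a = complex] by (simp add: add.commute)
  then show ?thesis
    unfolding growth_eq norm_divide norm_mult norm_power by simp
qed

text \<open>Numerator and denominator are estimated by the triangle inequality, which is sharp for
  both at the same point \<open>u = -1/2\<close>. So nothing is lost except in bounding
  \<open>quad_coeff n\<close> by 2, and even then \<open>n = 17\<close> leaves the inequality
  \<open>486 \<le> 493\<close>.\<close>
lemma growth_ge_1_on_circle:
  assumes n: "n \<ge> 17" and u: "norm u = 1 / 2"
  shows "1 \<le> norm (growth n u)"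
proof -
  define a where "a = quad_coeff n"
  have a: "0 \<le> a" "a \<le> 2"
    using quad_coeff_le[of n] by (auto simp: a_def quad_coeff_def)
  have "norm (of_nat n - 1 :: complex) = real n - 1"
    using n norm_of_nat[of "n - 1", where 'a = complex] by (simp add: of_nat_diff)
  moreover have "norm (of_real a * u\<^sup>2 - 2 * u) \<le> a / 4 + 1"
    using norm_triangle_ineq4[of "of_real a * u\<^sup>2" "2 * u"] u a
    by (simp add: norm_mult norm_power power2_eq_square)
  ultimately have num: "norm (of_real a * u\<^sup>2 - 2 * u - (of_nat n - 1)) \<ge> real n - 5 / 2"
    using norm_triangle_ineq3[of "of_nat n - 1" "of_real a * u\<^sup>2 - 2 * u"] a
    by (simp add: norm_minus_commute)
  have "norm (u - 1) \<le> 3 / 2"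
    using norm_triangle_ineq4[of u 1] u by simp
  then have den: "norm (u - 1) ^ 3 \<le> 27 / 8"
    using power_mono[of "norm (u - 1)" "3 / 2" 3] by (simp add: power3_eq_cube)
  have "norm (u - 1) > 0"
    using u by auto
  then have "1 / 2 * (real n - 5 / 2) / (27 / 8)
      \<le> norm u * norm (of_real a * u\<^sup>2 - 2 * u - (of_nat n - 1)) / norm (u - 1) ^ 3"
    using num den n u by (intro frac_le mult_mono) auto
  then have "real n / (2 * (real n + 1)) * (1 / 2 * (real n - 5 / 2) / (27 / 8)) \<le> norm (growth n u)"
    unfolding norm_growth a_def by (intro mult_left_mono) auto
  moreover have "1 \<le> real n / (2 * (real n + 1)) * (1 / 2 * (real n - 5 / 2) / (27 / 8))"
  proof -
    define x where "x = real n"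
    have "17 \<le> x"
      using n by (simp add: x_def)
    then have "32 * x + 27 \<le> 2 * (17 * x)"
      by simp
    also have "\<dots> \<le> 2 * (x * x)"
      using \<open>17 \<le> x\<close> by (intro mult_left_mono mult_right_mono) auto
    finally have "32 * x + 27 \<le> 2 * (x * x)" .
    with \<open>17 \<le> x\<close> show ?thesis
      unfolding x_def[symmetric] by (simp add: divide_simps) (simp add: algebra_simps)
  qed
  ultimately show ?thesis
    by linarith
qed

lemma growth_small_disc:
  assumes n: "1 \<le> n" "n \<le> 16" and u: "norm u \<le> 1 / 10"
  shows "norm (growth n u) \<le> 99 / 100"
proof -
  define a where "a = quad_coeff n"
  have a: "0 \<le> a" "a \<le> 2"
    using quad_coeff_le[of n] by (auto simp: a_def quad_coeff_def)
  have "norm u ^ 2 \<le> (1 / 10)\<^sup>2"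
    using u by (intro power_mono) auto
  then have "a * norm u ^ 2 \<le> 2 * (1 / 10)\<^sup>2"
    using a by (intro mult_mono) auto
  then have "norm (of_real a * u\<^sup>2 - 2 * u) \<le> 22 / 100"
    using norm_triangle_ineq4[of "of_real a * u\<^sup>2" "2 * u"] u a
    by (simp add: norm_mult norm_power power2_eq_square)
  moreover have "norm (of_nat n - 1 :: complex) \<le> 15"
    using n norm_of_nat[of "n - 1", where 'a = complex] by (simp add: of_nat_diff)
  ultimately have num: "norm (of_real a * u\<^sup>2 - 2 * u - (of_nat n - 1)) \<le> 1522 / 100"
    using norm_triangle_ineq4[of "of_real a * u\<^sup>2 - 2 * u" "of_nat n - 1"] by simp
  have "norm (u - 1) \<ge> 9 / 10"
    using norm_triangle_ineq2[of 1 u] u by (simp add: norm_minus_commute)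
  then have den: "norm (u - 1) ^ 3 \<ge> (9 / 10) ^ 3"
    by (intro power_mono) auto
  have "norm u * norm (of_real a * u\<^sup>2 - 2 * u - (of_nat n - 1)) / norm (u - 1) ^ 3
      \<le> 1 / 10 * (1522 / 100) / (9 / 10) ^ 3"
    using num den u by (intro frac_le mult_mono) auto
  moreover have "real n / (2 * (real n + 1)) \<le> 8 / 17"
    using n by (simp add: divide_simps)
  ultimately have "norm (growth n u) \<le> 8 / 17 * (1 / 10 * (1522 / 100) / (9 / 10) ^ 3)"
    unfolding norm_growth a_def by (intro mult_mono) auto
  also have "\<dots> \<le> 99 / 100"
    by (simp add: power3_eq_cube)
  finally show ?thesis .
qed

section \<open>The growth factor on the negative axis\<close>

text \<open>The negative of \<open>growth\<close> at \<open>u = - s\<close>. It is positive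
  exactly when the point is thrown across the origin, onto the opposite ray.\<close>
definition overshoot :: "nat \<Rightarrow> real \<Rightarrow> real" where
  "overshoot n s = real n / (2 * (real n + 1)) *
     (s * (real n - 1 - 2 * s - quad_coeff n * s\<^sup>2) / (1 + s) ^ 3)"

lemma growth_negative_axis: "growth n (- of_real s) = - of_real (overshoot n s)"
proof -
  define D where "D = (1 + s) ^ 3"
  define E where "E = real n - 1 - 2 * s - quad_coeff n * s\<^sup>2"
  have D: "(- of_real s - 1 :: complex) ^ 3 = - of_real D"
    by (simp add: D_def power3_eq_cube algebra_simps)
  have E: "of_real (quad_coeff n) * (- of_real s)\<^sup>2 - 2 * (- of_real s) - (of_nat n - 1)
      = (- of_real E :: complex)"
    by (simp add: E_def)
  show ?thesis
    unfolding growth_eq overshoot_def D E D_def[symmetric] E_def[symmetric] by simp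
qed

lemma overshoot_ge:
  assumes "1 \<le> n" "n \<le> 16" "0 \<le> s"
  shows "- 99 / 100 \<le> overshoot n s"
proof -
  have "quad_coeff n * s\<^sup>2 \<le> 2 * s\<^sup>2"
    using quad_coeff_le by (intro mult_right_mono) auto
  then have "2 * s + quad_coeff n * s\<^sup>2 - (real n - 1) \<le> 2 * s * (1 + s)"
    using assms by (simp add: algebra_simps power2_eq_square)
  then have "s * (2 * s + quad_coeff n * s\<^sup>2 - (real n - 1)) \<le> s * (2 * s * (1 + s))"
    using assms by (intro mult_left_mono)
  also have "\<dots> \<le> 2 * (1 + s) ^ 3"
    using assms by (simp add: power3_eq_cube algebra_simps)
  finally have "s * (2 * s + quad_coeff n * s\<^sup>2 - (real n - 1)) / (1 + s) ^ 3 \<le> 2"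
    using assms by (simp add: divide_simps)
  then have "real n / (2 * (real n + 1)) * (s * (2 * s + quad_coeff n * s\<^sup>2 - (real n - 1)) / (1 + s) ^ 3)
      \<le> real n / (2 * (real n + 1)) * 2"
    by (intro mult_left_mono) auto
  also have "\<dots> \<le> 99 / 100"
    using assms by (simp add: divide_simps)
  also have "real n / (2 * (real n + 1)) * (s * (2 * s + quad_coeff n * s\<^sup>2 - (real n - 1)) / (1 + s) ^ 3)
      = - overshoot n s"
    unfolding overshoot_def mult_minus_right[symmetric] minus_divide_left
    by (simp add: algebra_simps)
  finally show ?thesis
    by simp
qed

text \<open>Where it is positive, \<open>overshoot n s\<close> increases with \<open>n\<close>
  once \<open>quad_coeff n\<close> is replaced by its lower bound. One cubic inequality for
  \<open>N\<close> therefore serves all \<open>n \<le> N\<close>.\<close>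
lemma overshoot_le:
  assumes n: "2 \<le> n" "n \<le> N" and s: "0 \<le> s" and pos: "overshoot n s > 0"
    and cubic: "real N * (s * (real N - 1 - 2 * s - 5 / 3 * s\<^sup>2)) \<le> \<kappa> * (2 * (real N + 1) * (1 + s) ^ 3)"
  shows "overshoot n s \<le> \<kappa>"
proof -
  have "quad_coeff n * s\<^sup>2 \<ge> 5 / 3 * s\<^sup>2"
    using quad_coeff_ge[OF n(1)] by (intro mult_right_mono) auto
  then have A: "real n - 1 - 2 * s - quad_coeff n * s\<^sup>2 \<le> real N - 1 - 2 * s - 5 / 3 * s\<^sup>2"
    using n by simp
  have "real n - 1 - 2 * s - quad_coeff n * s\<^sup>2 > 0"
  proof (rule ccontr)
    assume "\<not> real n - 1 - 2 * s - quad_coeff n * s\<^sup>2 > 0"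
    then have "s * (real n - 1 - 2 * s - quad_coeff n * s\<^sup>2) \<le> 0"
      using s by (simp add: mult_nonneg_nonpos)
    then have "s * (real n - 1 - 2 * s - quad_coeff n * s\<^sup>2) / (1 + s) ^ 3 \<le> 0"
      using s by (intro divide_nonpos_nonneg) auto
    then have "overshoot n s \<le> 0"
      unfolding overshoot_def by (intro mult_nonneg_nonpos) auto
    with pos show False
      by simp
  qed
  moreover have "real n / (2 * (real n + 1)) \<le> real N / (2 * (real N + 1))"
    using n by (simp add: divide_simps) (simp add: algebra_simps)
  ultimately have "overshoot n s
      \<le> real N / (2 * (real N + 1)) * (s * (real N - 1 - 2 * s - 5 / 3 * s\<^sup>2) / (1 + s) ^ 3)"
    unfolding overshoot_def using A s by (intro mult_mono divide_right_mono) auto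
  also have "\<dots> \<le> \<kappa>"
    using cubic s by (simp add: divide_simps)
  finally show ?thesis .
qed

lemma overshoot_pos_imp_le:
  assumes n: "2 \<le> n" "real n - 1 \<le> 2 * \<sigma> + 5 / 3 * \<sigma>\<^sup>2" and \<sigma>: "0 \<le> \<sigma>"
    and s: "0 \<le> s" and pos: "overshoot n s > 0"
  shows "s \<le> \<sigma>"
proof (rule ccontr)
  assume "\<not> s \<le> \<sigma>"
  then have "s > \<sigma>"
    by simp
  then have "\<sigma>\<^sup>2 \<le> s\<^sup>2"
    using \<sigma> by (intro power_mono) auto
  then have "5 / 3 * \<sigma>\<^sup>2 \<le> quad_coeff n * s\<^sup>2"
    using quad_coeff_ge[OF n(1)] by (intro mult_mono) auto
  then have "real n - 1 - 2 * s - quad_coeff n * s\<^sup>2 \<le> 0"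
    using n \<open>s > \<sigma>\<close> by linarith
  then have "s * (real n - 1 - 2 * s - quad_coeff n * s\<^sup>2) \<le> 0"
    using s by (simp add: mult_nonneg_nonpos)
  then have "s * (real n - 1 - 2 * s - quad_coeff n * s\<^sup>2) / (1 + s) ^ 3 \<le> 0"
    using s by (intro divide_nonpos_nonneg) auto
  then have "overshoot n s \<le> 0"
    unfolding overshoot_def by (intro mult_nonneg_nonpos) auto
  with pos show False
    by simp
qed

text \<open>Each of the following inequalities compares cubics whose difference is convex for
  \<open>s \<ge> 0\<close>. So it suffices to bound the difference below near its minimum (or at
  the left end of the range): the cubic term by a multiple of \<open>s * (s - s0)\<^sup>2 \<ge>
  0\<close>, the quadratic remainder by a multiple of \<open>(s - s1)\<^sup>2 \<ge> 0\<close>,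
  with \<open>s0\<close> and \<open>s1\<close> close to the minimiser.\<close>
lemma cubic_bound_16:
  assumes "0 \<le> (s::real)"
  shows "16 * (s * (15 - 2 * s - 5 / 3 * s\<^sup>2)) \<le> 99 / 100 * (34 * (1 + s) ^ 3)"
proof -
  have "0 \<le> s * (s - 41 / 100)\<^sup>2" "0 \<le> (s - 41 / 100)\<^sup>2"
    using assms by simp_all
  then show ?thesis
    using assms by (simp add: power2_eq_square power3_eq_cube algebra_simps)
qed

lemma cubic_bound_15:
  assumes "0 \<le> (s::real)"
  shows "15 * (s * (14 - 2 * s - 5 / 3 * s\<^sup>2)) \<le> 177 / 200 * (32 * (1 + s) ^ 3)"
proof -
  have "0 \<le> s * (s - 21 / 50)\<^sup>2" "0 \<le> (s - 421 / 1000)\<^sup>2"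
    using assms by simp_all
  then show ?thesis
    using assms by (simp add: power2_eq_square power3_eq_cube algebra_simps)
qed

lemma cubic_bound_15_mid:
  assumes "3 / 5 \<le> (s::real)"
  shows "15 * (s * (14 - 2 * s - 5 / 3 * s\<^sup>2)) \<le> 17 / 20 * (32 * (1 + s) ^ 3)"
proof -
  have "0 \<le> s * (s - 3 / 5)\<^sup>2" "0 \<le> (s - 3 / 5)\<^sup>2"
    using assms by simp_all
  then show ?thesis
    using assms by (simp add: power2_eq_square power3_eq_cube algebra_simps)
qed

lemma cubic_bound_15_far:
  assumes "1 \<le> (s::real)"
  shows "15 * (s * (14 - 2 * s - 5 / 3 * s\<^sup>2)) \<le> 13 / 20 * (32 * (1 + s) ^ 3)"
proof -
  have "0 \<le> s * (s - 1)\<^sup>2" "0 \<le> (s - 1)\<^sup>2"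
    using assms by simp_all
  then show ?thesis
    using assms by (simp add: power2_eq_square power3_eq_cube algebra_simps)
qed

lemma cubic_bound_13:
  assumes "0 \<le> (s::real)"
  shows "13 * (s * (12 - 2 * s - 5 / 3 * s\<^sup>2)) \<le> 3 / 4 * (28 * (1 + s) ^ 3)"
proof -
  have "0 \<le> s * (s - 2 / 5)\<^sup>2" "0 \<le> (s - 41 / 100)\<^sup>2"
    using assms by simp_all
  then show ?thesis
    using assms by (simp add: power2_eq_square power3_eq_cube algebra_simps)
qed

lemma cubic_bound_9:
  assumes "0 \<le> (s::real)"
  shows "9 * (s * (8 - 2 * s - 5 / 3 * s\<^sup>2)) \<le> 1 / 2 * (20 * (1 + s) ^ 3)"
proof -
  have "0 \<le> s * (s - 17 / 50)\<^sup>2" "0 \<le> (s - 7 / 20)\<^sup>2"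
    using assms by simp_all
  then show ?thesis
    using assms by (simp add: power2_eq_square power3_eq_cube algebra_simps)
qed

lemma cubic_bound_5:
  assumes "0 \<le> (s::real)"
  shows "5 * (s * (4 - 2 * s - 5 / 3 * s\<^sup>2)) \<le> 1 / 5 * (12 * (1 + s) ^ 3)"
proof -
  have "0 \<le> s * (s - 29 / 100)\<^sup>2" "0 \<le> (s - 3 / 10)\<^sup>2"
    using assms by simp_all
  then show ?thesis
    using assms by (simp add: power2_eq_square power3_eq_cube algebra_simps)
qed

lemma abs_overshoot_le:
  assumes "2 \<le> n" "n \<le> 16" "0 \<le> s"
  shows "\<bar>overshoot n s\<bar> \<le> 99 / 100"
proof (cases "overshoot n s > 0")
  case True
  then show ?thesis
    using overshoot_le[of n 16 s "99 / 100"] cubic_bound_16[of s] assms by simp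
next
  case False
  then show ?thesis
    using overshoot_ge[of n s] assms by simp
qed

lemma mult_power_le:
  fixes x :: real
  assumes "0 \<le> x" "x \<le> \<kappa>" "\<kappa> \<le> 1" "m \<le> n" "0 \<le> s" "s \<le> \<sigma>" "\<sigma> * \<kappa> ^ m \<le> b"
  shows "s * x ^ n \<le> b"
proof -
  have "x ^ n \<le> \<kappa> ^ n"
    using assms by (intro power_mono) auto
  also have "\<dots> \<le> \<kappa> ^ m"
    using assms by (intro power_decreasing) auto
  finally have "s * x ^ n \<le> \<sigma> * \<kappa> ^ m"
    using assms by (intro mult_mono) auto
  with assms show ?thesis
    by simp
qed

text \<open>The image of \<open>u = - s\<close> has modulus \<open>s * overshoot n s ^ n\<close>, so the bound says that it lies in
  the disc contracted by \<open>growth_small_disc\<close>. For \<open>n \<le> 13\<close> a bound on \<open>overshoot\<close> that does not depend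
  on \<open>s\<close> is enough, with a better constant for smaller \<open>n\<close>. For \<open>n = 15\<close> the maximum of \<open>overshoot\<close> is
  about \<open>0.88\<close>, and its fifteenth power only suffices for small \<open>s\<close>; hence the range of \<open>s\<close> is split.\<close>
lemma odd_landing:
  assumes n: "2 \<le> n" "n \<le> 15" "odd n" and s: "0 \<le> s" and pos: "overshoot n s > 0"
  shows "s * overshoot n s ^ n \<le> 1 / 10"
proof -
  let ?q = "overshoot n s"
  have q0: "0 \<le> ?q"
    using pos by simp
  consider "n = 15" | "3 \<le> n" "n \<le> 5" | "7 \<le> n" "n \<le> 9" | "11 \<le> n" "n \<le> 13"
  proof -
    have "n = 15 \<or> 3 \<le> n \<and> n \<le> 5 \<or> 7 \<le> n \<and> n \<le> 9 \<or> 11 \<le> n \<and> n \<le> 13"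
      using n by presburger
    then show thesis
      using that by blast
  qed
  then show ?thesis
  proof cases
    case 1
    note bnd = overshoot_le[OF _ _ s pos, of 15]
    consider "s \<le> 3 / 5" | "3 / 5 \<le> s" "s \<le> 1" | "1 \<le> s" 
      by linarith
    then show ?thesis
    proof cases
      assume "s \<le> 3 / 5"
      moreover have "?q \<le> 177 / 200"
        by (rule bnd) (use 1 cubic_bound_15[OF s] in auto)
      ultimately show ?thesis
        using 1 by (intro mult_power_le[OF q0, of "177 / 200" 15 n s "3 / 5"] s) (simp_all add: power_divide)
    next
      assume "3 / 5 \<le> s" "s \<le> 1"
      moreover from this have "?q \<le> 17 / 20"
        by (intro bnd) (use 1 cubic_bound_15_mid[of s] in auto)
      ultimately show ?thesis
        using 1 by (intro mult_power_le[OF q0, of "17 / 20" 15 n s 1] s) (simp_all add: power_divide)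
    next
      assume "1 \<le> s"
      moreover from this have "?q \<le> 13 / 20"
        by (intro bnd) (use 1 cubic_bound_15_far[of s] in auto)
      moreover have "s \<le> 3"
        by (rule overshoot_pos_imp_le[OF _ _ _ s pos]) (use 1 in auto)
      ultimately show ?thesis
        using 1 by (intro mult_power_le[OF q0, of "13 / 20" 15 n s 3] s) (simp_all add: power_divide)
    qed
  next
    case 2
    then have "?q \<le> 1 / 5" "s \<le> 9 / 4"
      using overshoot_le[OF _ _ s pos, of 5 "1 / 5"] cubic_bound_5[OF s] overshoot_pos_imp_le[OF _ _ _ s pos, of "9 / 4"]
      by (auto simp: power2_eq_square)
    with 2 show ?thesis
      by (intro mult_power_le[OF q0, of "1 / 5" 3 n s "9 / 4"] s) (simp_all add: power_divide)
  next
    case 3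
    then have "?q \<le> 1 / 2" "s \<le> 9 / 4"
      using overshoot_le[OF _ _ s pos, of 9 "1 / 2"] cubic_bound_9[OF s] overshoot_pos_imp_le[OF _ _ _ s pos, of "9 / 4"]
      by (auto simp: power2_eq_square)
    with 3 show ?thesis
      by (intro mult_power_le[OF q0, of "1 / 2" 7 n s "9 / 4"] s) (simp_all add: power_divide)
  next
    case 4
    then have "?q \<le> 3 / 4" "s \<le> 9 / 4"
      using overshoot_le[OF _ _ s pos, of 13 "3 / 4"] cubic_bound_13[OF s] overshoot_pos_imp_le[OF _ _ _ s pos, of "9 / 4"]
      by (auto simp: power2_eq_square)
    with 4 show ?thesis
      by (intro mult_power_le[OF q0, of "3 / 4" 11 n s "9 / 4"] s) (simp_all add: power_divide)
  qed
qed

section \<open>Basins on the sphere and in the plane\<close>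

lemma limitin_riemann_sphere_Some:
  "limitin riemann_sphere (\<lambda>m. Some (g m)) (Some a) F \<longleftrightarrow> (g \<longlongrightarrow> a) F"
proof
  assume L: "limitin riemann_sphere (\<lambda>m. Some (g m)) (Some a) F"
  show "(g \<longlongrightarrow> a) F"
  proof (rule topological_tendstoI)
    fix U assume "open U" "a \<in> U"
    then have "openin riemann_sphere (Some ` U)" "Some a \<in> Some ` U"
      by (auto simp: riemann_sphere_def)
    from limitinD[OF L this] show "eventually (\<lambda>x. g x \<in> U) F"
      by (rule eventually_mono) auto
  qed
next
  assume "(g \<longlongrightarrow> a) F"
  then have "limitin euclidean g a F"
    by simp
  from continuous_map_limit[OF continuous_map_Some this]
  show "limitin riemann_sphere (\<lambda>m. Some (g m)) (Some a) F"
    by (simp add: riemann_sphere_def comp_def)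
qed

lemma connectedin_riemann_sphere_Some:
  "connectedin riemann_sphere (Some ` K) \<longleftrightarrow> connected K"
proof
  assume "connected K"
  then have "connectedin euclidean K"
    by simp
  then show "connectedin riemann_sphere (Some ` K)"
    unfolding riemann_sphere_def
    by (rule connectedin_continuous_map_image[OF continuous_map_Some])
next
  assume conn: "connectedin riemann_sphere (Some ` K)"
  show "connected K"
  proof (rule connectedI)
    fix U V assume UV: "open U" "open V" "U \<inter> K \<noteq> {}" "V \<inter> K \<noteq> {}" "U \<inter> V \<inter> K = {}" "K \<subseteq> U \<union> V"
    then have "openin riemann_sphere (Some ` U)" "openin riemann_sphere (Some ` V)"
      by (auto simp: riemann_sphere_def)
    moreover have "Some ` K \<subseteq> Some ` U \<union> Some ` V" "Some ` U \<inter> Some ` V \<inter> Some ` K = {}"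
      "Some ` U \<inter> Some ` K \<noteq> {}" "Some ` V \<inter> Some ` K \<noteq> {}"
      using UV by auto
    ultimately show False
      using conn unfolding connectedin by blast
  qed
qed

lemma basin_step_iff: "f z \<in> basin f w \<longleftrightarrow> z \<in> basin f w"
proof -
  have "limitin riemann_sphere (\<lambda>m. (f ^^ m) (f z)) w sequentially
      \<longleftrightarrow> limitin riemann_sphere (\<lambda>m. (f ^^ (m + 1)) z) w sequentially"
    by (simp add: funpow_swap1)
  also have "\<dots> \<longleftrightarrow> limitin riemann_sphere (\<lambda>m. (f ^^ m) z) w sequentially"
    using limitin_sequentially_offset[of riemann_sphere "\<lambda>m. (f ^^ m) z" w 1]
      limitin_sequentially_offset_rev[of riemann_sphere "\<lambda>m. (f ^^ m) z" 1 w] by auto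
  finally show ?thesis
    by (simp add: basin_def)
qed

lemma None_notin_basin:
  assumes "f None = None"
  shows "None \<notin> basin f (Some a)"
proof
  assume "None \<in> basin f (Some a)"
  moreover have "(f ^^ m) None = None" for m
    by (induction m) (simp_all add: assms)
  ultimately have "limitin riemann_sphere (\<lambda>m. None) (Some a) sequentially"
    by (simp add: basin_def)
  moreover have "openin riemann_sphere (Some ` UNIV)"
    by (simp add: riemann_sphere_def)
  ultimately have "eventually (\<lambda>m. None \<in> (Some ` UNIV :: complex option set)) sequentially"
    by (rule limitinD) simp
  then show False
    by simp
qed

text \<open>The barrier only has to be non-strict: an orbit on the sphere of radius
  \<open>\<rho>\<close> that never leaves the closed ball would stay on that sphere for ever, and
  so would not converge to 0. This makes the points whose orbits stay in the ball an open as well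
  as closed part of \<open>B\<close>.\<close>
lemma connected_basin_trapped:
  fixes c :: "'a::real_normed_vector \<Rightarrow> 'a"
  assumes cont: "continuous_on B c" and inv: "\<And>z. z \<in> B \<Longrightarrow> c z \<in> B"
    and conv: "\<And>z. z \<in> B \<Longrightarrow> (\<lambda>m. (c ^^ m) z) \<longlonglongrightarrow> 0"
    and r: "0 < r" "r \<le> \<rho>"
    and small: "\<And>z. z \<in> B \<Longrightarrow> norm z < r \<Longrightarrow> norm (c z) \<le> norm z"
    and barrier: "\<And>z. z \<in> B \<Longrightarrow> norm z = \<rho> \<Longrightarrow> norm (c z) \<ge> \<rho>"
    and K: "connected K" "K \<subseteq> B" "0 \<in> K"
  shows "K \<subseteq> cball 0 \<rho>"
proof -
  define it where "it = (\<lambda>m. c ^^ m)"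
  have itB: "it m z \<in> B" if "z \<in> B" for m z
    using that by (induction m) (simp_all add: it_def inv)
  have it_add: "it (m + k) z = it k (it m z)" for m k z
    by (metis add.commute comp_apply funpow_add it_def)
  have itc: "continuous_on B (it m)" for m
  proof (induction m)
    case (Suc m)
    have "continuous_on B (c \<circ> it m)"
      using Suc itB by (intro continuous_on_compose continuous_on_subset[OF cont]) auto
    then show ?case
      by (simp add: it_def)
  qed (simp add: it_def continuous_on_id)
  have decay: "norm (it m z) \<le> norm z" if "z \<in> B" "norm z < r" for m z
  proof (induction m)
    case (Suc m)
    then have "norm (it m z) < r"
      using that(2) by simp
    then have "norm (c (it m z)) \<le> norm (it m z)"
      using small itB that(1) by blast
    with Suc show ?case
      by (simp add: it_def)
  qed (simp add: it_def)
  have enters: "\<exists>N. norm (it N z) < r" if "z \<in> B" for z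
    using LIMSEQ_D[OF conv[OF that] r(1)] by (auto simp: it_def)
  define G where "G = {z \<in> B. \<forall>m. norm (it m z) \<le> \<rho>}"
  have G_strict: "norm (it m z) < \<rho>" if "z \<in> G" for m z
  proof (rule ccontr)
    assume "\<not> norm (it m z) < \<rho>"
    with that have start: "norm (it m z) = \<rho>" and le: "\<And>m. norm (it m z) \<le> \<rho>" and zB: "z \<in> B"
      by (auto simp: G_def intro: antisym)
    have stays: "norm (it (m + k) z) = \<rho>" for k
    proof (induction k)
      case (Suc k)
      then have "norm (it (m + Suc k) z) \<ge> \<rho>"
        using barrier[OF itB[OF zB]] by (simp add: it_def)
      with le show ?case
        by (simp add: antisym)
    qed (simp add: start)
    obtain N where "norm (it N (it m z)) < r"
      using enters itB[OF zB] by blast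
    with stays[of N] r(2) show False
      by (simp add: it_add)
  qed
  have "closedin (top_of_set B) (\<Inter>m. {z \<in> B. norm (it m z) \<le> \<rho>})"
  proof (rule closedin_INT)
    fix m
    have "closedin (top_of_set B) (B \<inter> it m -` cball 0 \<rho>)"
      by (intro continuous_closedin_preimage itc) auto
    moreover have "B \<inter> it m -` cball 0 \<rho> = {z \<in> B. norm (it m z) \<le> \<rho>}"
      by auto
    ultimately show "closedin (top_of_set B) {z \<in> B. norm (it m z) \<le> \<rho>}"
      by simp
  qed simp
  also have "(\<Inter>m. {z \<in> B. norm (it m z) \<le> \<rho>}) = G"
    by (auto simp: G_def)
  finally have closed: "closedin (top_of_set B) G" .
  \<comment> \<open>Near a point of \<open>G\<close> only finitely many conditions matter: after \<open>N\<close> steps the orbit is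
    trapped in the small ball.\<close>
  have "openin (top_of_set B) G"
  proof (subst openin_subopen, intro ballI)
    fix z assume zG: "z \<in> G"
    then have zB: "z \<in> B"
      by (simp add: G_def)
    then obtain N where N: "norm (it N z) < r"
      using enters by blast
    define W where "W = (B \<inter> it N -` ball 0 r) \<inter> (\<Inter>m\<in>{..N}. B \<inter> it m -` ball 0 \<rho>)"
    have "openin (top_of_set B) W"
      unfolding W_def
      by (intro openin_Int openin_INT2 continuous_openin_preimage_gen itc) auto
    moreover have "z \<in> W"
      using zB N G_strict[OF zG] by (auto simp: W_def)
    moreover have "W \<subseteq> G"
    proof
      fix y assume y: "y \<in> W"
      then have yB: "y \<in> B" and yN: "norm (it N y) < r"
        by (auto simp: W_def)
      have "norm (it m y) \<le> \<rho>" for m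
      proof (cases "m \<le> N")
        case True
        with y show ?thesis
          by (auto simp: W_def less_imp_le)
      next
        case False
        then have "it m y = it (m - N) (it N y)"
          using it_add[of N "m - N" y] by simp
        with decay[OF itB[OF yB] yN, of "m - N"] yN r(2) show ?thesis
          by simp
      qed
      with yB show "y \<in> G"
        by (simp add: G_def)
    qed
    ultimately show "\<exists>T. openin (top_of_set B) T \<and> z \<in> T \<and> T \<subseteq> G"
      by (intro exI[of _ W]) simp
  qed
  then obtain U where "open U" "G = B \<inter> U"
    by (auto simp: openin_open)
  then have "openin (top_of_set K) (K \<inter> G)"
    using K(2) by (auto simp: openin_open intro!: exI[of _ U])
  moreover obtain V where "closed V" "G = B \<inter> V"
    using closed by (auto simp: closedin_closed)
  then have "closedin (top_of_set K) (K \<inter> G)"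
    using K(2) by (auto simp: closedin_closed intro!: exI[of _ V])
  moreover have "0 \<in> G"
  proof -
    have "norm (it m 0) \<le> \<rho>" for m
      using decay[of 0 m] K r by auto
    then show ?thesis
      using K by (auto simp: G_def)
  qed
  ultimately have "K \<inter> G = K"
    using K unfolding connected_clopen by blast
  then have "K \<subseteq> G"
    by auto
  then show ?thesis
    using G_strict[of _ 0] by (force simp: it_def)
qed

lemma contracting_orbit_tendsto_0:
  fixes c :: "'a::real_normed_vector \<Rightarrow> 'a"
  assumes inv: "\<And>z. z \<in> T \<Longrightarrow> c z \<in> T"
    and contr: "\<And>z. z \<in> T \<Longrightarrow> norm (c z) \<le> \<kappa> * norm z"
    and \<kappa>: "0 \<le> \<kappa>" "\<kappa> < 1" and "z \<in> T"
  shows "(\<lambda>m. (c ^^ m) z) \<longlonglongrightarrow> 0"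
proof -
  have bound: "(c ^^ m) z \<in> T \<and> norm ((c ^^ m) z) \<le> \<kappa> ^ m * norm z" for m
  proof (induction m)
    case (Suc m)
    then have "norm (c ((c ^^ m) z)) \<le> \<kappa> * norm ((c ^^ m) z)"
      using contr by blast
    also have "\<dots> \<le> \<kappa> * (\<kappa> ^ m * norm z)"
      using Suc \<kappa> by (intro mult_left_mono) auto
    finally show ?case
      using Suc inv by simp
  qed (use \<open>z \<in> T\<close> in simp)
  have "(\<lambda>m. \<kappa> ^ m * norm z) \<longlonglongrightarrow> 0 * norm z"
    using \<kappa> by (intro tendsto_mult tendsto_const LIMSEQ_power_zero) simp
  then have lim: "(\<lambda>m. \<kappa> ^ m * norm z) \<longlonglongrightarrow> 0"
    by simp
  show ?thesis
    by (rule Lim_null_comparison[OF _ lim], rule always_eventually) (use bound in blast)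
qed

section \<open>The basin of the origin for the Chebyshev map\<close>

definition plane_basin :: "nat \<Rightarrow> complex set" where
  "plane_basin n = Some -` basin (chebyshev (p_poly n)) (Some 0)"

lemma scaled_power_scale: "scaled_power n (z * g) = scaled_power n z * g ^ n"
  by (simp add: scaled_power_def power_mult_distrib)

lemma norm_scaled_power: "norm (scaled_power n z) = (real n + 1) * norm z ^ n"
proof -
  have "norm (of_nat n + 1 :: complex) = real n + 1"
    using norm_of_nat[of "n + 1", where 'a = complex] by (simp add: add.commute)
  then show ?thesis
    by (simp add: scaled_power_def norm_mult norm_power)
qed

lemma scaled_power_neq_1_if_plane_basin:
  assumes "n > 0" "z \<in> plane_basin n"
  shows "scaled_power n z \<noteq> 1"
proof
  assume "scaled_power n z = 1"
  then have "chebyshev (p_poly n) (Some z) = None"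
    using assms chebyshev_pole by blast
  moreover have "chebyshev (p_poly n) (Some z) \<in> basin (chebyshev (p_poly n)) (Some 0)"
    using assms by (simp add: basin_step_iff plane_basin_def)
  ultimately show False
    using None_notin_basin chebyshev_None assms(1) by metis
qed

lemma cheb_step_plane_basin:
  assumes "n > 0" "z \<in> plane_basin n"
  shows "cheb_step n z \<in> plane_basin n"
proof -
  have "chebyshev (p_poly n) (Some z) \<in> basin (chebyshev (p_poly n)) (Some 0)"
    using assms by (simp add: basin_step_iff plane_basin_def)
  then show ?thesis
    using chebyshev_Some[OF assms(1) scaled_power_neq_1_if_plane_basin[OF assms]]
    by (simp add: plane_basin_def)
qed

text \<open>The set \<open>T\<close> guarantees that the orbit avoids the poles. It is
  instantiated both with the basin itself and with sets that are yet to be shown to lie in the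
  basin.\<close>
lemma funpow_chebyshev_Some:
  assumes "n > 0" "z \<in> T"
    and "\<And>z. z \<in> T \<Longrightarrow> scaled_power n z \<noteq> 1" "\<And>z. z \<in> T \<Longrightarrow> cheb_step n z \<in> T"
  shows "(chebyshev (p_poly n) ^^ m) (Some z) = Some ((cheb_step n ^^ m) z)"
proof -
  have "(cheb_step n ^^ m) z \<in> T \<and>
      (chebyshev (p_poly n) ^^ m) (Some z) = Some ((cheb_step n ^^ m) z)"
    using assms by (induction m) (simp_all add: chebyshev_Some)
  then show ?thesis
    by blast
qed

lemma plane_basin_tendsto:
  assumes "n > 0" "z \<in> plane_basin n"
  shows "(\<lambda>m. (cheb_step n ^^ m) z) \<longlonglongrightarrow> 0"
proof -
  have "(chebyshev (p_poly n) ^^ m) (Some z) = Some ((cheb_step n ^^ m) z)" for m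
    by (rule funpow_chebyshev_Some[OF assms])
       (simp_all add: assms(1) scaled_power_neq_1_if_plane_basin cheb_step_plane_basin)
  moreover have "limitin riemann_sphere (\<lambda>m. (chebyshev (p_poly n) ^^ m) (Some z)) (Some 0) sequentially"
    using assms(2) by (simp add: plane_basin_def basin_def)
  ultimately show ?thesis
    by (simp add: limitin_riemann_sphere_Some)
qed

lemma plane_basinI:
  assumes "n > 0" "z \<in> T"
    and "\<And>z. z \<in> T \<Longrightarrow> scaled_power n z \<noteq> 1" "\<And>z. z \<in> T \<Longrightarrow> cheb_step n z \<in> T"
    and "(\<lambda>m. (cheb_step n ^^ m) z) \<longlonglongrightarrow> 0"
  shows "z \<in> plane_basin n"
  using assms(5)
  by (simp add: plane_basin_def basin_def funpow_chebyshev_Some[OF assms(1-4)]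
      limitin_riemann_sphere_Some)

lemma cheb_step_0 [simp]: "cheb_step n 0 = 0"
  by (simp add: cheb_step_def)

lemma zero_in_plane_basin:
  assumes "n > 0"
  shows "0 \<in> plane_basin n"
proof (rule plane_basinI[of n 0 "{0}"])
  have "(cheb_step n ^^ m) 0 = 0" for m
    by (induction m) simp_all
  then show "(\<lambda>m. (cheb_step n ^^ m) 0) \<longlonglongrightarrow> 0"
    by simp
qed (use assms in \<open>auto simp: scaled_power_def zero_power\<close>)

lemma basin_eq_plane_basin:
  assumes "n > 0"
  shows "basin (chebyshev (p_poly n)) (Some 0) = Some ` plane_basin n"
proof -
  have "None \<notin> basin (chebyshev (p_poly n)) (Some 0)"
    by (intro None_notin_basin chebyshev_None assms)
  then show ?thesis
    by (auto simp: plane_basin_def image_iff) (metis not_None_eq)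
qed

lemma A0_in_plane_basin:
  assumes "n > 0"
  shows "Some -` A0 n \<subseteq> plane_basin n" "connected (Some -` A0 n)" "0 \<in> Some -` A0 n"
proof -
  define X where "X = subtopology riemann_sphere (Some ` plane_basin n)"
  have A0: "A0 n = connected_component_of_set X (Some 0)"
    by (simp add: A0_def immediate_basin_def basin_eq_plane_basin[OF assms] X_def)
  have "connectedin X (A0 n)"
    by (simp add: A0 connectedin_connected_component_of)
  then have conn: "connectedin riemann_sphere (A0 n)" and sub: "A0 n \<subseteq> Some ` plane_basin n"
    by (auto simp: X_def connectedin_subtopology)
  then have "A0 n = Some ` (Some -` A0 n)"
    by auto
  with conn show "connected (Some -` A0 n)"
    by (metis connectedin_riemann_sphere_Some)
  from sub show "Some -` A0 n \<subseteq> plane_basin n"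
    by auto
  have "Some 0 \<in> topspace X"
    using zero_in_plane_basin[OF assms] by (auto simp: X_def riemann_sphere_def)
  then show "0 \<in> Some -` A0 n"
    by (simp add: A0 connected_component_of_refl)
qed

lemma A0_maximal:
  assumes "n > 0" "connected K" "0 \<in> K" "K \<subseteq> plane_basin n"
  shows "K \<subseteq> Some -` A0 n"
proof -
  have "connectedin (subtopology riemann_sphere (Some ` plane_basin n)) (Some ` K)"
    using assms by (auto simp: connectedin_subtopology connectedin_riemann_sphere_Some)
  then have "Some ` K \<subseteq> A0 n"
    unfolding A0_def immediate_basin_def basin_eq_plane_basin[OF assms(1)]
    by (rule connected_component_of_maximal) (use assms in auto)
  then show ?thesis
    by auto
qed

lemma continuous_on_cheb_step:
  "continuous_on {z. scaled_power n z \<noteq> 1} (cheb_step n)"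
proof -
  have "2 * (of_nat n + 1) * (scaled_power n z - 1) ^ 3 \<noteq> 0" if "scaled_power n z \<noteq> 1" for z
    using that of_nat_plus_1_nonzero[of n] by (simp del: distrib_left_numeral)
  then show ?thesis
    unfolding cheb_step_def growth_def scaled_power_def by (intro continuous_intros) simp
qed

lemma cheb_step_contracts_near_0:
  assumes "n > 0"
  obtains r where "0 < r" "\<And>z. norm z < r \<Longrightarrow> norm (cheb_step n z) \<le> norm z"
proof -
  have u0: "scaled_power n 0 = 0"
    using assms by (simp add: scaled_power_def zero_power)
  have nz: "2 * (of_nat n + 1) * (scaled_power n 0 - 1) ^ 3 \<noteq> 0"
    using of_nat_plus_1_nonzero[of n] by (simp add: u0 del: distrib_left_numeral)
  have "isCont (\<lambda>z. growth n (scaled_power n z)) 0"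
    unfolding growth_def scaled_power_def by (intro continuous_intros nz[unfolded scaled_power_def])
  then have "((\<lambda>z. growth n (scaled_power n z)) \<longlongrightarrow> growth n 0) (at 0)"
    by (simp add: isCont_def u0)
  then have lim: "((\<lambda>z. growth n (scaled_power n z)) \<longlongrightarrow> 0) (at 0)"
    by (simp add: growth_def)
  obtain r where r: "0 < r" "\<And>z. z \<noteq> 0 \<Longrightarrow> norm z < r \<Longrightarrow> norm (growth n (scaled_power n z)) < 1"
    using LIM_D[OF lim, of 1] by auto
  have "norm (cheb_step n z) \<le> norm z" if "norm z < r" for z
  proof (cases "z = 0")
    case False
    with r(2) that have "norm (growth n (scaled_power n z)) \<le> 1"
      by (simp add: less_imp_le)
    then have "norm z * norm (growth n (scaled_power n z)) \<le> norm z * 1"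
      by (intro mult_left_mono) auto
    then show ?thesis
      by (simp add: cheb_step_def norm_mult)
  qed simp
  with r(1) that show thesis
    by blast
qed

section \<open>Bounded immediate basins\<close>

lemma bounded_A0:
  assumes "n \<ge> 17"
  shows "bounded (Some -` A0 n)"
proof -
  have n: "n > 0"
    using assms by simp
  \<comment> \<open>The radius of the circle \<open>\<bar>u\<bar> = 1/2\<close> in the \<open>z\<close>-plane.\<close>
  define \<rho> where "\<rho> = root n (1 / (2 * (real n + 1)))"
  have "\<rho> > 0"
    using n by (simp add: \<rho>_def)
  have \<rho>n: "\<rho> ^ n = 1 / (2 * (real n + 1))"
    using n by (simp add: \<rho>_def)
  obtain r where r: "0 < r" "\<And>z. norm z < r \<Longrightarrow> norm (cheb_step n z) \<le> norm z"
    using cheb_step_contracts_near_0[OF n] by blast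
  have "Some -` A0 n \<subseteq> cball 0 \<rho>"
  proof (rule connected_basin_trapped[where c = "cheb_step n" and B = "plane_basin n" and r = "min r \<rho>"])
    show "continuous_on (plane_basin n) (cheb_step n)"
      by (rule continuous_on_subset[OF continuous_on_cheb_step])
         (use scaled_power_neq_1_if_plane_basin[OF n] in auto)
    show "\<rho> \<le> norm (cheb_step n z)" if "norm z = \<rho>" for z
    proof -
      have "norm (scaled_power n z) = 1 / 2"
        by (simp add: norm_scaled_power that \<rho>n)
      then have "\<rho> * 1 \<le> \<rho> * norm (growth n (scaled_power n z))"
        using growth_ge_1_on_circle[OF assms] \<open>\<rho> > 0\<close> by (intro mult_left_mono) auto
      then show ?thesis
        by (simp add: cheb_step_def norm_mult that)
    qed
  qed (use r \<open>\<rho> > 0\<close> A0_in_plane_basin[OF n] plane_basin_tendsto[OF n] cheb_step_plane_basin[OF n] in auto)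
  then show ?thesis
    using bounded_cball bounded_subset by blast
qed

section \<open>Unbounded immediate basins\<close>

text \<open>The rays over \<open>u \<le> 0\<close> are not invariant if \<open>n\<close> is odd;
  the disc is added to catch the points that leave them. The radius \<open>1/10\<close> is small
  enough for the disc to be contracted for all \<open>n \<le> 16\<close>, and large enough for
  \<open>odd_landing\<close>.\<close>
definition contracted :: "nat \<Rightarrow> complex set" where
  "contracted n = {z. norm (scaled_power n z) \<le> 1 / 10 \<or> (\<exists>s\<ge>0. scaled_power n z = - of_real s)}"

lemma scaled_power_neq_1_if_contracted: "z \<in> contracted n \<Longrightarrow> scaled_power n z \<noteq> 1"
proof
  assume "z \<in> contracted n" "scaled_power n z = 1"
  then obtain s :: real where "0 \<le> s" "1 = - (of_real s :: complex)"
    by (auto simp: contracted_def)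
  then show False
    by (simp add: complex_eq_iff)
qed

lemma norm_growth_contracted:
  assumes "2 \<le> n" "n \<le> 16" "z \<in> contracted n"
  shows "norm (growth n (scaled_power n z)) \<le> 99 / 100"
  using assms(3) unfolding contracted_def
proof (safe)
  assume "norm (scaled_power n z) \<le> 1 / 10"
  then show ?thesis
    using growth_small_disc assms by simp
next
  fix s :: real assume "0 \<le> s" "scaled_power n z = - of_real s"
  then show ?thesis
    using abs_overshoot_le[OF assms(1,2), of s] by (simp add: growth_negative_axis)
qed

lemma cheb_step_contracted:
  assumes n: "2 \<le> n" "n \<le> 16" and z: "z \<in> contracted n"
  shows "cheb_step n z \<in> contracted n"
proof -
  have step: "scaled_power n (cheb_step n z) = scaled_power n z * growth n (scaled_power n z) ^ n"
    by (simp add: cheb_step_def scaled_power_scale)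
  from z consider "norm (scaled_power n z) \<le> 1 / 10" | s where "0 \<le> s" "scaled_power n z = - of_real s"
    by (auto simp: contracted_def)
  then show ?thesis
  proof cases
    case 1
    have "norm (growth n (scaled_power n z)) ^ n \<le> 1"
      using norm_growth_contracted[OF n z] by (intro power_le_one) auto
    then have "norm (scaled_power n z) * norm (growth n (scaled_power n z)) ^ n \<le> 1 / 10 * 1"
      using 1 by (intro mult_mono) auto
    then show ?thesis
      by (simp add: contracted_def step norm_mult norm_power)
  next
    case 2
    define q where "q = overshoot n s"
    have u: "scaled_power n (cheb_step n z) = - of_real (s * (- q) ^ n)"
      by (simp add: step 2 growth_negative_axis q_def)
    show ?thesis
    proof (cases "q > 0 \<and> odd n")
      case True
      then have "odd n"
        by simp
      then have "n \<le> 15"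
        using n by presburger
      with True have "s * q ^ n \<le> 1 / 10"
        using odd_landing[of n s] n 2 by (simp add: q_def)
      then have "norm (scaled_power n (cheb_step n z)) \<le> 1 / 10"
        using True 2 by (simp only: u norm_minus_cancel norm_of_real) (simp add: abs_mult)
      then show ?thesis
        by (simp add: contracted_def)
    next
      case False
      then have "0 \<le> (- q) ^ n"
        by (cases "q > 0") auto
      then have "0 \<le> s * (- q) ^ n"
        using 2(1) by simp
      with u show ?thesis
        unfolding contracted_def mem_Collect_eq by (intro disjI2 exI conjI)
    qed
  qed
qed

lemma contracted_subset_plane_basin:
  assumes n: "2 \<le> n" "n \<le> 16"
  shows "contracted n \<subseteq> plane_basin n"
proof
  fix z assume z: "z \<in> contracted n"
  have contr: "norm (cheb_step n z) \<le> 99 / 100 * norm z" if "z \<in> contracted n" for z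
    using mult_left_mono[OF norm_growth_contracted[OF n that], of "norm z"]
    by (simp add: cheb_step_def norm_mult)
  have "(\<lambda>m. (cheb_step n ^^ m) z) \<longlonglongrightarrow> 0"
    by (rule contracting_orbit_tendsto_0[OF cheb_step_contracted[OF n] contr _ _ z]) auto
  then show "z \<in> plane_basin n"
    using n by (intro plane_basinI[OF _ z scaled_power_neq_1_if_contracted cheb_step_contracted[OF n]]) auto
qed

lemma unbounded_A0:
  assumes n: "2 \<le> n" "n \<le> 16"
  shows "\<not> bounded (Some -` A0 n)"
proof -
  \<comment> \<open>The direction \<open>cis (pi / n)\<close> is an \<open>n\<close>-th root of \<open>-1\<close>.\<close>
  define ray where "ray = (\<lambda>r. of_real r * cis (pi / real n)) ` {0..}"
  have "connected ray"
    unfolding ray_def by (intro connected_continuous_image continuous_intros) auto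
  moreover have "0 \<in> ray"
    by (auto simp: ray_def image_iff intro!: bexI[of _ 0])
  moreover have "ray \<subseteq> contracted n"
  proof
    fix z assume "z \<in> ray"
    then obtain r where r: "r \<ge> 0" "z = of_real r * cis (pi / real n)"
      by (auto simp: ray_def)
    have "cis (pi / real n) ^ n = cis (real n * (pi / real n))"
      by (rule Complex.DeMoivre)
    also have "real n * (pi / real n) = pi"
      using n by simp
    finally have "cis (pi / real n) ^ n = -1"
      by (simp only: cis_pi)
    then have "scaled_power n z = - of_real ((real n + 1) * r ^ n)"
      by (simp add: scaled_power_def r(2) power_mult_distrib)
    moreover have "0 \<le> (real n + 1) * r ^ n"
      using r by simp
    ultimately show "z \<in> contracted n"
      unfolding contracted_def mem_Collect_eq by (intro disjI2 exI conjI)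
  qed
  ultimately have sub: "ray \<subseteq> Some -` A0 n"
    using n contracted_subset_plane_basin[OF n] by (intro A0_maximal) auto
  have "\<not> bounded ray"
  proof
    assume "bounded ray"
    then obtain M where M: "\<And>z. z \<in> ray \<Longrightarrow> norm z \<le> M"
      by (auto simp: bounded_iff)
    have "of_real (\<bar>M\<bar> + 1) * cis (pi / real n) \<in> ray"
      unfolding ray_def by (rule imageI) simp
    moreover have "norm (of_real (\<bar>M\<bar> + 1) * cis (pi / real n)) = \<bar>M\<bar> + 1"
      by (simp only: norm_mult norm_of_real norm_cis) simp
    ultimately have "\<bar>M\<bar> + 1 \<le> M"
      using M by metis
    then show False
      by linarith
  qed
  with sub show ?thesis
    using bounded_subset by blast
qed

theorem theorem3:
  fixes n :: nat
  assumes "n > 1"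
  shows "(n \<le> 16 \<longrightarrow> \<not> bounded (Some -` A0 n)) \<and> (n \<ge> 17 \<longrightarrow> bounded (Some -` A0 n))"
  using assms bounded_A0[of n] unbounded_A0[of n] by simp

end
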